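(* Let $\langle U,\theta\rangle$ be an approximation space, let $C(R_\theta)$ denote the center of its principal rough set algebra $R_\theta$, and let $E$ be the indexing set for the equivalence classes of $\theta$. Then $C(R_\theta)$ is exactly the set of crisp sets of $R_\theta$ (that is, the set of rough sets $\langle\underline{X},\overline{X}\rangle$ with $X\subseteq U$ and $X=\underline{X}=\overline{X}$), and $C(R_\theta)$ is complete, atomistic and isomorphic to $2^E$ as a Boolean algebra.
   Context: An approximation space $\langle U,\theta\rangle$ is a nonempty set $U$ with an equivalence relation $\theta$; $\theta_x$ denotes the $\theta$-class of $x$. The indexing set $E$ of the classes is a set in bijection with the set of $\theta$-classes. For $X\subseteq U$, $\overline{X}=\bigcup\{\theta_x:\theta_x\cap X\neq\emptyset\}$ and $\underline{X}=\bigcup\{\theta_x:\theta_x\subseteq X\}$; the pair $\langle\underline{X},\overline{X}\rangle$ is a rough set. $R_\theta$ is the set of all rough sets $\langle\underline{X},\overline{X}\rangle$, $X\subseteq U$. Complements $^c$ are in $U$. A set $X\subseteq U$ is crisp (or definable) if $X=\underline{X}=\overline{X}$; it is identified with the rough set $\langle X,X\rangle$. The principal rough set algebra, also denoted $R_\theta$, has $0=\langle\emptyset,\emptyset\rangle$, $1=\langle U,U\rangle$, componentwise union as $\vee$, componentwise intersection as $\wedge$, $\langle\underline{X},\overline{X}\rangle^*=\langle\overline{X}^c,\overline{X}^c\rangle$ and $\langle\underline{X},\overline{X}\rangle^+=\langle\underline{X}^c,\underline{X}^c\rangle$. It is a regular double Stone algebra (a bounded distributive lattice with pseudocomplement $^*$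 and dual pseudocomplement $^+$ satisfying $x^*\vee x^{**}=1$, $x^+\wedge x^{++}=0$, and $x\wedge x^+\le y\vee y^*$ for all $x,y$). The center of a regular double Stone algebra $L$ is $C(L)=\{x\in L:x^*=x^+\}$, which is a Boolean algebra under the induced $\wedge,\vee$ and $^*$ (as complement). $2^E$ denotes the Boolean algebra of all subsets of $E$. In a lattice with least element $0$, an atom is an $a>0$ with no $x$ satisfying $0<x<a$; the lattice is atomistic if every element is the join of a set of atoms, and complete if every subset has a supremum and an infimum. *)

theory Defs
  imports "HOL-Algebra.Complete_Lattice"
begin

section \<open>Approximation spaces and rough sets\<close>

locale approximation_space =
  fixes U :: "'a set" and \<theta> :: "('a \<times> 'a) set"
  assumes nonempty: "U \<noteq> {}"
    and equiv: "equiv U \<theta>"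

definition upper_approx :: "'a set \<Rightarrow> ('a \<times> 'a) set \<Rightarrow> 'a set \<Rightarrow> 'a set"
  where "upper_approx U \<theta> X = \<Union> {\<theta> `` {x} |x. x \<in> U \<and> \<theta> `` {x} \<inter> X \<noteq> {}}"

definition lower_approx :: "'a set \<Rightarrow> ('a \<times> 'a) set \<Rightarrow> 'a set \<Rightarrow> 'a set"
  where "lower_approx U \<theta> X = \<Union> {\<theta> `` {x} |x. x \<in> U \<and> \<theta> `` {x} \<subseteq> X}"

definition rough_set :: "'a set \<Rightarrow> ('a \<times> 'a) set \<Rightarrow> 'a set \<Rightarrow> 'a set \<times> 'a set"
  where "rough_set U \<theta> X = (lower_approx U \<theta> X, upper_approx U \<theta> X)"

definition rough_sets :: "'a set \<Rightarrow> ('a \<times> 'a) set \<Rightarrow> ('a set \<times> 'a set) set"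
  where "rough_sets U \<theta> = {rough_set U \<theta> X |X. X \<subseteq> U}"

definition crisp :: "'a set \<Rightarrow> ('a \<times> 'a) set \<Rightarrow> 'a set \<Rightarrow> bool"
  where "crisp U \<theta> X \<longleftrightarrow> X = lower_approx U \<theta> X \<and> lower_approx U \<theta> X = upper_approx U \<theta> X"

definition crisp_sets :: "'a set \<Rightarrow> ('a \<times> 'a) set \<Rightarrow> ('a set \<times> 'a set) set"
  where "crisp_sets U \<theta> = {rough_set U \<theta> X |X. X \<subseteq> U \<and> crisp U \<theta> X}"


section \<open>Bounded distributive lattices, Boolean algebras, double Stone algebras\<close>

record 'a bl_alg = "'a partial_object" +
  bl_join :: "'a \<Rightarrow> 'a \<Rightarrow> 'a" (infixl \<open>\<curlyvee>\<index>\<close> 65)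
  bl_meet :: "'a \<Rightarrow> 'a \<Rightarrow> 'a" (infixl \<open>\<curlywedge>\<index>\<close> 70)
  bl_zero :: 'a (\<open>\<zero>\<index>\<close>)
  bl_one :: 'a (\<open>\<one>\<index>\<close>)

record 'a bool_alg = "'a bl_alg" +
  ba_compl :: "'a \<Rightarrow> 'a"

record 'a ds_alg = "'a bl_alg" +
  ds_star :: "'a \<Rightarrow> 'a"
  ds_plus :: "'a \<Rightarrow> 'a"

definition order_of :: "('a, 'b) bl_alg_scheme \<Rightarrow> 'a gorder"
  where "order_of L = \<lparr>carrier = carrier L, eq = (=), le = (\<lambda>x y. x \<curlywedge>\<^bsub>L\<^esub> y = x)\<rparr>"

locale bounded_distrib_lattice =
  fixes L :: "('a, 'b) bl_alg_scheme" (structure)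
  assumes join_closed: "\<lbrakk>x \<in> carrier L; y \<in> carrier L\<rbrakk> \<Longrightarrow> x \<curlyvee> y \<in> carrier L"
    and meet_closed: "\<lbrakk>x \<in> carrier L; y \<in> carrier L\<rbrakk> \<Longrightarrow> x \<curlywedge> y \<in> carrier L"
    and zero_closed: "\<zero> \<in> carrier L"
    and one_closed: "\<one> \<in> carrier L"
    and join_assoc: "\<lbrakk>x \<in> carrier L; y \<in> carrier L; z \<in> carrier L\<rbrakk> \<Longrightarrow> x \<curlyvee> y \<curlyvee> z = x \<curlyvee> (y \<curlyvee> z)"
    and meet_assoc: "\<lbrakk>x \<in> carrier L; y \<in> carrier L; z \<in> carrier L\<rbrakk> \<Longrightarrow> x \<curlywedge> y \<curlywedge> z = x \<curlywedge> (y \<curlywedge> z)"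
    and join_comm: "\<lbrakk>x \<in> carrier L; y \<in> carrier L\<rbrakk> \<Longrightarrow> x \<curlyvee> y = y \<curlyvee> x"
    and meet_comm: "\<lbrakk>x \<in> carrier L; y \<in> carrier L\<rbrakk> \<Longrightarrow> x \<curlywedge> y = y \<curlywedge> x"
    and join_absorb: "\<lbrakk>x \<in> carrier L; y \<in> carrier L\<rbrakk> \<Longrightarrow> x \<curlyvee> (x \<curlywedge> y) = x"
    and meet_absorb: "\<lbrakk>x \<in> carrier L; y \<in> carrier L\<rbrakk> \<Longrightarrow> x \<curlywedge> (x \<curlyvee> y) = x"
    and meet_join_distrib: "\<lbrakk>x \<in> carrier L; y \<in> carrier L; z \<in> carrier L\<rbrakk>
          \<Longrightarrow> x \<curlywedge> (y \<curlyvee> z) = (x \<curlywedge> y) \<curlyvee> (x \<curlywedge> z)"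
    and join_zero: "x \<in> carrier L \<Longrightarrow> x \<curlyvee> \<zero> = x"
    and meet_one: "x \<in> carrier L \<Longrightarrow> x \<curlywedge> \<one> = x"

locale boolean_alg = bounded_distrib_lattice B for B :: "('a, 'b) bool_alg_scheme" (structure) +
  assumes compl_closed: "x \<in> carrier B \<Longrightarrow> ba_compl B x \<in> carrier B"
    and join_compl: "x \<in> carrier B \<Longrightarrow> x \<curlyvee> ba_compl B x = \<one>"
    and meet_compl: "x \<in> carrier B \<Longrightarrow> x \<curlywedge> ba_compl B x = \<zero>"

locale regular_double_stone_alg = bounded_distrib_lattice L
  for L :: "('a, 'b) ds_alg_scheme" (structure) +
  assumes star_closed: "x \<in> carrier L \<Longrightarrow> ds_star L x \<in> carrier L"
    and plus_closed: "x \<in> carrier L \<Longrightarrow> ds_plus L x \<in> carrier L"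
    and pseudocompl: "\<lbrakk>x \<in> carrier L; y \<in> carrier L\<rbrakk>
          \<Longrightarrow> x \<curlywedge> y = \<zero> \<longleftrightarrow> y \<sqsubseteq>\<^bsub>order_of L\<^esub> ds_star L x"
    and dual_pseudocompl: "\<lbrakk>x \<in> carrier L; y \<in> carrier L\<rbrakk>
          \<Longrightarrow> x \<curlyvee> y = \<one> \<longleftrightarrow> ds_plus L x \<sqsubseteq>\<^bsub>order_of L\<^esub> y"
    and stone: "x \<in> carrier L \<Longrightarrow> ds_star L x \<curlyvee> ds_star L (ds_star L x) = \<one>"
    and dual_stone: "x \<in> carrier L \<Longrightarrow> ds_plus L x \<curlywedge> ds_plus L (ds_plus L x) = \<zero>"
    and regular: "\<lbrakk>x \<in> carrier L; y \<in> carrier L\<rbrakk>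
          \<Longrightarrow> x \<curlywedge> ds_plus L x \<sqsubseteq>\<^bsub>order_of L\<^esub> y \<curlyvee> ds_star L y"

definition center :: "('a, 'b) ds_alg_scheme \<Rightarrow> 'a bool_alg"
  where "center L =
    \<lparr>carrier = {x \<in> carrier L. ds_star L x = ds_plus L x},
     bl_join = bl_join L, bl_meet = bl_meet L, bl_zero = bl_zero L, bl_one = bl_one L,
     ba_compl = ds_star L\<rparr>"

definition powerset_alg :: "'i set \<Rightarrow> 'i set bool_alg"
  where "powerset_alg E =
    \<lparr>carrier = Pow E, bl_join = (\<union>), bl_meet = (\<inter>), bl_zero = {}, bl_one = E,
     ba_compl = (\<lambda>A. E - A)\<rparr>"

definition boolean_iso :: "('a, 'c) bool_alg_scheme \<Rightarrow> ('b, 'd) bool_alg_scheme \<Rightarrow> ('a \<Rightarrow> 'b) set"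
  where "boolean_iso A B = {f. bij_betw f (carrier A) (carrier B) \<and>
    (\<forall>x \<in> carrier A. \<forall>y \<in> carrier A. f (x \<curlyvee>\<^bsub>A\<^esub> y) = f x \<curlyvee>\<^bsub>B\<^esub> f y) \<and>
    (\<forall>x \<in> carrier A. \<forall>y \<in> carrier A. f (x \<curlywedge>\<^bsub>A\<^esub> y) = f x \<curlywedge>\<^bsub>B\<^esub> f y) \<and>
    f \<zero>\<^bsub>A\<^esub> = \<zero>\<^bsub>B\<^esub> \<and> f \<one>\<^bsub>A\<^esub> = \<one>\<^bsub>B\<^esub> \<and>
    (\<forall>x \<in> carrier A. f (ba_compl A x) = ba_compl B (f x))}"

definition boolean_isomorphic :: "('a, 'c) bool_alg_scheme \<Rightarrow> ('b, 'd) bool_alg_scheme \<Rightarrow> bool"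
  where "boolean_isomorphic A B \<longleftrightarrow> boolean_alg A \<and> boolean_alg B \<and> boolean_iso A B \<noteq> {}"


section \<open>Atomistic lattices\<close>

definition atoms :: "('a, 'b) gorder_scheme \<Rightarrow> 'a set"
  where "atoms L = {a \<in> carrier L. \<bottom>\<^bsub>L\<^esub> \<sqsubset>\<^bsub>L\<^esub> a \<and>
    \<not> (\<exists>x \<in> carrier L. \<bottom>\<^bsub>L\<^esub> \<sqsubset>\<^bsub>L\<^esub> x \<and> x \<sqsubset>\<^bsub>L\<^esub> a)}"

definition atomistic :: "('a, 'b) gorder_scheme \<Rightarrow> bool"
  where "atomistic L \<longleftrightarrow> (\<forall>x \<in> carrier L. \<exists>A \<subseteq> atoms L. is_lub L x A)"


section \<open>The principal rough set algebra\<close>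

definition rough_set_alg :: "'a set \<Rightarrow> ('a \<times> 'a) set \<Rightarrow> ('a set \<times> 'a set) ds_alg"
  where "rough_set_alg U \<theta> =
    \<lparr>carrier = rough_sets U \<theta>,
     bl_join = (\<lambda>(A, B) (C, D). (A \<union> C, B \<union> D)),
     bl_meet = (\<lambda>(A, B) (C, D). (A \<inter> C, B \<inter> D)),
     bl_zero = ({}, {}),
     bl_one = (U, U),
     ds_star = (\<lambda>(A, B). (U - B, U - B)),
     ds_plus = (\<lambda>(A, B). (U - A, U - A))\<rparr>"

context approximation_space
begin

lemma
  shows theta_refl: "x \<in> U \<Longrightarrow> (x, x) \<in> \<theta>"
    and theta_sym: "(x, y) \<in> \<theta> \<Longrightarrow> (y, x) \<in> \<theta>"
    and theta_trans: "(x, y) \<in> \<theta> \<Longrightarrow> (y, z) \<in> \<theta> \<Longrightarrow> (x, z) \<in> \<theta>"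
    and theta_in: "(x, y) \<in> \<theta> \<Longrightarrow> x \<in> U \<and> y \<in> U"
  using equiv unfolding equiv_def by (auto dest: refl_onD symD transD)

lemma mem_upper_approx: "x \<in> upper_approx U \<theta> X \<longleftrightarrow> x \<in> U \<and> (\<exists>y \<in> X. (x, y) \<in> \<theta>)"
proof
  assume "x \<in> upper_approx U \<theta> X"
  then obtain z y where "(z, x) \<in> \<theta>" "(z, y) \<in> \<theta>" "y \<in> X"
    unfolding upper_approx_def by blast
  then show "x \<in> U \<and> (\<exists>y \<in> X. (x, y) \<in> \<theta>)"
    using theta_in[of z x] theta_trans[OF theta_sym[of z x], of y] by blast
next
  assume "x \<in> U \<and> (\<exists>y \<in> X. (x, y) \<in> \<theta>)"
  then show "x \<in> upper_approx U \<theta> X"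
    using theta_refl[of x] unfolding upper_approx_def by blast
qed

lemma mem_lower_approx: "x \<in> lower_approx U \<theta> X \<longleftrightarrow> x \<in> U \<and> (\<forall>y. (x, y) \<in> \<theta> \<longrightarrow> y \<in> X)"
proof
  assume "x \<in> lower_approx U \<theta> X"
  then obtain z where z: "(z, x) \<in> \<theta>" "\<theta> `` {z} \<subseteq> X"
    unfolding lower_approx_def by blast
  then show "x \<in> U \<and> (\<forall>y. (x, y) \<in> \<theta> \<longrightarrow> y \<in> X)"
    using theta_in[OF z(1)] theta_trans[OF z(1)] by blast
next
  assume "x \<in> U \<and> (\<forall>y. (x, y) \<in> \<theta> \<longrightarrow> y \<in> X)"
  then show "x \<in> lower_approx U \<theta> X"
    using theta_refl[of x] unfolding lower_approx_def by blast
qed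

text \<open>A pair of definable sets \<open>A \<subseteq> B\<close> is a rough set iff \<open>B - A\<close> contains no
  one-element class; this is what makes rough sets closed under the componentwise operations.\<close>

lemma mem_rough_sets_iff:
  "(A, B) \<in> rough_sets U \<theta> \<longleftrightarrow> A \<subseteq> B \<and> B \<subseteq> U \<and>
    (\<forall>x y. (x, y) \<in> \<theta> \<longrightarrow> x \<in> A \<longrightarrow> y \<in> A) \<and> (\<forall>x y. (x, y) \<in> \<theta> \<longrightarrow> x \<in> B \<longrightarrow> y \<in> B) \<and>
    (\<forall>x \<in> B - A. \<exists>y. (x, y) \<in> \<theta> \<and> y \<noteq> x)" (is "?l \<longleftrightarrow> ?r")
proof
  assume ?l
  then obtain X where A: "A = lower_approx U \<theta> X" and B: "B = upper_approx U \<theta> X"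
    by (auto simp: rough_sets_def rough_set_def)
  have "A \<subseteq> B"
  proof
    fix x assume "x \<in> A"
    then have "x \<in> U" "x \<in> X" using theta_refl[of x] by (auto simp: A mem_lower_approx)
    then show "x \<in> B" using theta_refl[of x] by (auto simp: B mem_upper_approx)
  qed
  moreover have "B \<subseteq> U"
    unfolding B by (auto simp: mem_upper_approx)
  moreover have "\<forall>x y. (x, y) \<in> \<theta> \<longrightarrow> x \<in> A \<longrightarrow> y \<in> A"
    unfolding A mem_lower_approx using theta_in theta_trans by blast
  moreover have "\<forall>x y. (x, y) \<in> \<theta> \<longrightarrow> x \<in> B \<longrightarrow> y \<in> B"
    unfolding B mem_upper_approx using theta_in theta_trans theta_sym by blast
  moreover have "\<forall>x \<in> B - A. \<exists>y. (x, y) \<in> \<theta> \<and> y \<noteq> x"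
  proof
    fix x assume "x \<in> B - A"
    then obtain y z where "(x, y) \<in> \<theta>" "y \<in> X" "(x, z) \<in> \<theta>" "z \<notin> X"
      by (auto simp: A B mem_lower_approx mem_upper_approx)
    then show "\<exists>y. (x, y) \<in> \<theta> \<and> y \<noteq> x" by (cases "x = y") auto
  qed
  ultimately show ?r by (intro conjI)
next
  assume r: ?r
  define c where "c x = (SOME y. y \<in> \<theta> `` {x})" for x
  have c_in: "(x, c x) \<in> \<theta>" if "x \<in> U" for x
    using someI[of "\<lambda>y. y \<in> \<theta> `` {x}" x] theta_refl[OF that] by (simp add: c_def)
  have c_eq: "c x = c y" if "(x, y) \<in> \<theta>" for x y
    using equiv_class_eq[OF equiv that] by (simp add: c_def)
  define Z where "Z = A \<union> {x \<in> B - A. c x = x}"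
  have "A = lower_approx U \<theta> Z"
  proof (intro Set.set_eqI iffI)
    fix x assume "x \<in> A"
    then show "x \<in> lower_approx U \<theta> Z" using r by (auto simp: mem_lower_approx Z_def)
  next
    fix x assume "x \<in> lower_approx U \<theta> Z"
    then have x: "x \<in> U" "\<And>y. (x, y) \<in> \<theta> \<Longrightarrow> y \<in> Z" by (auto simp: mem_lower_approx)
    show "x \<in> A"
    proof (rule ccontr)
      assume "x \<notin> A"
      then have xB: "x \<in> B - A" "c x = x" using x(2)[OF theta_refl[OF x(1)]] by (auto simp: Z_def)
      then obtain y where y: "(x, y) \<in> \<theta>" "y \<noteq> x" using r by blast
      have "y \<notin> A" using r theta_sym[OF y(1)] xB(1) by blast
      then have "c y = y" using x(2)[OF y(1)] by (auto simp: Z_def)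
      then show False using c_eq[OF y(1)] xB(2) y(2) by simp
    qed
  qed
  moreover have "B = upper_approx U \<theta> Z"
  proof (intro Set.set_eqI iffI)
    fix x assume xB: "x \<in> B"
    then have xU: "x \<in> U" using r by blast
    show "x \<in> upper_approx U \<theta> Z"
    proof (cases "x \<in> A")
      case True
      then show ?thesis using xU theta_refl[OF xU] by (auto simp: mem_upper_approx Z_def)
    next
      case False
      have "c x \<in> B" using r c_in[OF xU] xB by blast
      moreover have "c x \<notin> A" using r theta_sym[OF c_in[OF xU]] False by blast
      moreover have "c (c x) = c x" using c_eq[OF c_in[OF xU]] by simp
      ultimately show ?thesis using xU c_in[OF xU] by (auto simp: mem_upper_approx Z_def)
    qed
  next
    fix x assume "x \<in> upper_approx U \<theta> Z"
    then obtain y where "y \<in> Z" "(x, y) \<in> \<theta>" by (auto simp: mem_upper_approx)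
    moreover from this have "y \<in> B" using r by (auto simp: Z_def)
    ultimately show "x \<in> B" using r theta_sym[of x y] by blast
  qed
  moreover have "Z \<subseteq> U" using r by (auto simp: Z_def)
  ultimately have "(A, B) = rough_set U \<theta> Z \<and> Z \<subseteq> U" by (simp only: rough_set_def)
  then show ?l unfolding rough_sets_def by blast
qed

lemma regular_double_stone_rough_set_alg: "regular_double_stone_alg (rough_set_alg U \<theta>)"
proof -
  have join: "(A \<union> C, B \<union> D) \<in> rough_sets U \<theta>"
    if "(A, B) \<in> rough_sets U \<theta>" "(C, D) \<in> rough_sets U \<theta>" for A B C D
    using that unfolding mem_rough_sets_iff by blast
  have meet: "(A \<inter> C, B \<inter> D) \<in> rough_sets U \<theta>"
    if "(A, B) \<in> rough_sets U \<theta>" "(C, D) \<in> rough_sets U \<theta>" for A B C D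
    using that unfolding mem_rough_sets_iff by blast
  have diag: "(D, D) \<in> rough_sets U \<theta>"
    if "D \<subseteq> U" "\<And>x y. (x, y) \<in> \<theta> \<Longrightarrow> x \<in> D \<Longrightarrow> y \<in> D" for D
    unfolding mem_rough_sets_iff using that by auto
  have compl: "(U - B, U - B) \<in> rough_sets U \<theta>" "(U - A, U - A) \<in> rough_sets U \<theta>"
    if AB: "(A, B) \<in> rough_sets U \<theta>" for A B
  proof -
    have "y \<in> A \<Longrightarrow> x \<in> A" "y \<in> B \<Longrightarrow> x \<in> B" if "(x, y) \<in> \<theta>" for x y
      using AB theta_sym[OF that] unfolding mem_rough_sets_iff by blast+
    then show "(U - B, U - B) \<in> rough_sets U \<theta>" "(U - A, U - A) \<in> rough_sets U \<theta>"
      using theta_in by (auto intro!: diag)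
  qed
  have bounds: "({}, {}) \<in> rough_sets U \<theta>" "(U, U) \<in> rough_sets U \<theta>"
    using theta_in by (auto intro!: diag)
  have sub: "A \<subseteq> B" "B \<subseteq> U" if "(A, B) \<in> rough_sets U \<theta>" for A B
    using that unfolding mem_rough_sets_iff by blast+
  note ops = rough_set_alg_def order_of_def
  show ?thesis
  proof
    fix x y
    assume "x \<in> carrier (rough_set_alg U \<theta>)" "y \<in> carrier (rough_set_alg U \<theta>)"
    then obtain A B C D where xy: "x = (A, B)" "y = (C, D)"
      and mem: "(A, B) \<in> rough_sets U \<theta>" "(C, D) \<in> rough_sets U \<theta>"
      by (cases x; cases y) (auto simp: ops)
    have le: "A \<subseteq> B" "B \<subseteq> U" "C \<subseteq> D" "D \<subseteq> U"
      using sub mem by blast+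
    show "x \<curlyvee>\<^bsub>rough_set_alg U \<theta>\<^esub> y \<in> carrier (rough_set_alg U \<theta>)"
      using join[OF mem] by (simp add: ops xy)
    show "x \<curlywedge>\<^bsub>rough_set_alg U \<theta>\<^esub> y \<in> carrier (rough_set_alg U \<theta>)"
      using meet[OF mem] by (simp add: ops xy)
    show "(x \<curlywedge>\<^bsub>rough_set_alg U \<theta>\<^esub> y = \<zero>\<^bsub>rough_set_alg U \<theta>\<^esub>)
      = (y \<sqsubseteq>\<^bsub>order_of (rough_set_alg U \<theta>)\<^esub> ds_star (rough_set_alg U \<theta>) x)"
      using le by (simp add: ops xy) blast
    show "(x \<curlyvee>\<^bsub>rough_set_alg U \<theta>\<^esub> y = \<one>\<^bsub>rough_set_alg U \<theta>\<^esub>)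
      = (ds_plus (rough_set_alg U \<theta>) x \<sqsubseteq>\<^bsub>order_of (rough_set_alg U \<theta>)\<^esub> y)"
      using le by (simp add: ops xy) blast
    show "x \<curlywedge>\<^bsub>rough_set_alg U \<theta>\<^esub> ds_plus (rough_set_alg U \<theta>) x
      \<sqsubseteq>\<^bsub>order_of (rough_set_alg U \<theta>)\<^esub> y \<curlyvee>\<^bsub>rough_set_alg U \<theta>\<^esub> ds_star (rough_set_alg U \<theta>) y"
      using le by (simp add: ops xy) blast
    show "ds_star (rough_set_alg U \<theta>) x \<in> carrier (rough_set_alg U \<theta>)"
      "ds_plus (rough_set_alg U \<theta>) x \<in> carrier (rough_set_alg U \<theta>)"
      using compl[OF mem(1)] by (simp_all add: ops xy)
    show "x \<curlyvee>\<^bsub>rough_set_alg U \<theta>\<^esub> \<zero>\<^bsub>rough_set_alg U \<theta>\<^esub> = x"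
      by (simp add: ops xy)
    show "x \<curlywedge>\<^bsub>rough_set_alg U \<theta>\<^esub> \<one>\<^bsub>rough_set_alg U \<theta>\<^esub> = x"
      using le by (simp add: ops xy) blast
  qed (auto simp: ops bounds split: prod.splits)
qed

end

end

(* A rough set (A, B) is central iff A = B, so the center is the field of unions of
   theta-classes. Its joins and meets are unions and intersections and its atoms are the
   classes. Choosing a representative r i of every class cls i, the isomorphism onto 2^E sends
   a union of classes D to the set of all i with r i in D. *)

theory Submission
  imports Defs
begin

text \<open>For an equivalence \<theta> on \<open>U\<close> these are exactly the unions of classes.
  The closure form makes stability under set operations an elementwise check.\<close>

definition definable :: "'a set \<Rightarrow> ('a \<times> 'a) set \<Rightarrow> 'a set \<Rightarrow> bool"
  where "definable U \<theta> D \<longleftrightarrow> D \<subseteq> U \<and> \<theta> `` D \<subseteq> D"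

lemma definable_UN: "(\<And>i. i \<in> I \<Longrightarrow> definable U \<theta> (D i)) \<Longrightarrow> definable U \<theta> (\<Union>i\<in>I. D i)"
  unfolding definable_def by blast

lemma definable_Un: "definable U \<theta> C \<Longrightarrow> definable U \<theta> D \<Longrightarrow> definable U \<theta> (C \<union> D)"
  unfolding definable_def by blast

lemma definable_Int: "definable U \<theta> C \<Longrightarrow> definable U \<theta> D \<Longrightarrow> definable U \<theta> (C \<inter> D)"
  unfolding definable_def by blast

lemma definable_empty: "definable U \<theta> {}"
  unfolding definable_def by blast

lemma boolean_alg_powerset: "boolean_alg (powerset_alg E)"
  by unfold_locales (auto simp: powerset_alg_def)

context approximation_space
begin

lemma definable_space: "definable U \<theta> U"
  using theta_in unfolding definable_def by blast

text \<open>The intersection with \<open>U\<close> covers the empty family, whose bare intersection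
  is the whole type instead of the top element \<open>U\<close>.\<close>

lemma definable_INT:
  assumes "\<And>i. i \<in> I \<Longrightarrow> definable U \<theta> (D i)"
  shows "definable U \<theta> (U \<inter> (\<Inter>i\<in>I. D i))"
  unfolding definable_def
proof (intro conjI subsetI)
  fix y assume "y \<in> \<theta> `` (U \<inter> (\<Inter>i\<in>I. D i))"
  then obtain x where x: "(x, y) \<in> \<theta>" "\<And>i. i \<in> I \<Longrightarrow> x \<in> D i"
    by blast
  have "y \<in> D i" if "i \<in> I" for i
    using assms[OF that] x(1) x(2)[OF that] unfolding definable_def by blast
  then show "y \<in> U \<inter> (\<Inter>i\<in>I. D i)"
    using theta_in[OF x(1)] by blast
qed blast

text \<open>Symmetry carries closure over to complements: a point of \<open>D\<close> related to a
  point outside \<open>D\<close> would force the latter into \<open>D\<close>.\<close>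

lemma definable_Diff: "definable U \<theta> D \<Longrightarrow> definable U \<theta> (U - D)"
  using theta_in theta_sym unfolding definable_def by blast

text \<open>By transitivity the image under \<theta> is already closed. This yields both the single
  classes and the unions of classes given by a set of representatives.\<close>

lemma definable_saturation: "X \<subseteq> U \<Longrightarrow> definable U \<theta> (\<theta> `` X)"
  using theta_in theta_trans unfolding definable_def by blast

lemma definable_mem_cong: "definable U \<theta> D \<Longrightarrow> (x, y) \<in> \<theta> \<Longrightarrow> x \<in> D \<longleftrightarrow> y \<in> D"
  using theta_sym unfolding definable_def by blast

section \<open>Approximations of definable sets; crisp sets\<close>

lemma lower_approx_definable:
  assumes D: "definable U \<theta> D"
  shows "lower_approx U \<theta> D = D"
proof (intro Set.set_eqI iffI)
  fix x assume "x \<in> lower_approx U \<theta> D"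
  then show "x \<in> D"
    using theta_refl unfolding mem_lower_approx by blast
next
  fix x assume "x \<in> D"
  then show "x \<in> lower_approx U \<theta> D"
    using D unfolding mem_lower_approx definable_def by blast
qed

lemma upper_approx_definable:
  assumes D: "definable U \<theta> D"
  shows "upper_approx U \<theta> D = D"
proof (intro Set.set_eqI iffI)
  fix x assume "x \<in> upper_approx U \<theta> D"
  then show "x \<in> D"
    using definable_mem_cong[OF D] by (auto simp: mem_upper_approx)
next
  fix x assume "x \<in> D"
  moreover from this have "x \<in> U"
    using D by (auto simp: definable_def)
  ultimately show "x \<in> upper_approx U \<theta> D"
    using theta_refl by (auto simp: mem_upper_approx)
qed

text \<open>Being fixed by the lower approximation means containing the class of each of one's
  points, which is closure under \<theta>. Conversely, both approximations fix a definable
  set.\<close>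

lemma crisp_iff_definable: "crisp U \<theta> D \<longleftrightarrow> definable U \<theta> D"
proof
  assume "crisp U \<theta> D"
  then have D: "D = lower_approx U \<theta> D"
    unfolding crisp_def by blast
  show "definable U \<theta> D"
    unfolding definable_def
  proof
    show "D \<subseteq> U"
      using D mem_lower_approx by blast
    show "\<theta> `` D \<subseteq> D"
      using D mem_lower_approx by blast
  qed
next
  assume "definable U \<theta> D"
  then show "crisp U \<theta> D"
    by (simp add: crisp_def lower_approx_definable upper_approx_definable)
qed

lemma crisp_sets_eq: "crisp_sets U \<theta> = (\<lambda>D. (D, D)) ` {D. definable U \<theta> D}"
proof -
  have "crisp_sets U \<theta> = rough_set U \<theta> ` {D. definable U \<theta> D}"
    unfolding crisp_sets_def crisp_iff_definable by (auto simp: definable_def)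
  also have "\<dots> = (\<lambda>D. (D, D)) ` {D. definable U \<theta> D}"
    by (rule image_cong)
      (simp_all add: rough_set_def lower_approx_definable upper_approx_definable)
  finally show ?thesis .
qed

section \<open>The center as a Boolean algebra of definable sets\<close>

lemma diagonal_rough_set_iff: "(D, D) \<in> rough_sets U \<theta> \<longleftrightarrow> definable U \<theta> D"
  \<comment> \<open>On the diagonal the condition on one-element classes ranges over
    \<open>D - D\<close> and is vacuous.\<close>
  by (auto simp: mem_rough_sets_iff definable_def)

abbreviation RC :: "('a set \<times> 'a set) bool_alg"
  where "RC \<equiv> center (rough_set_alg U \<theta>)"

text \<open>For a rough set \<open>(A, B)\<close> the two pseudocomplements agree iff
  \<open>U - B = U - A\<close>. Since \<open>A\<close> and \<open>B\<close> lie in \<open>U\<close>,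
  complements cancel and \<open>A = B\<close>.\<close>

lemma carrier_RC: "carrier RC = (\<lambda>D. (D, D)) ` {D. definable U \<theta> D}"
proof (intro equalityI subrelI)
  fix A B assume "(A, B) \<in> carrier RC"
  then have AB: "(A, B) \<in> rough_sets U \<theta>" "U - B = U - A"
    by (simp_all add: center_def rough_set_alg_def)
  then have "A \<subseteq> U" "B \<subseteq> U"
    unfolding mem_rough_sets_iff by blast+
  with AB(2) have "A = B"
    by blast
  with AB(1) show "(A, B) \<in> (\<lambda>D. (D, D)) ` {D. definable U \<theta> D}"
    by (simp add: diagonal_rough_set_iff)
next
  fix A B assume "(A, B) \<in> (\<lambda>D. (D, D)) ` {D. definable U \<theta> D}"
  then have "A = B" "definable U \<theta> B"
    by auto
  then show "(A, B) \<in> carrier RC"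
    by (simp add: center_def rough_set_alg_def diagonal_rough_set_iff)
qed

lemma RC_simps:
  "(A, B) \<curlyvee>\<^bsub>RC\<^esub> (C, D) = (A \<union> C, B \<union> D)"
  "(A, B) \<curlywedge>\<^bsub>RC\<^esub> (C, D) = (A \<inter> C, B \<inter> D)"
  "\<zero>\<^bsub>RC\<^esub> = ({}, {})"
  "\<one>\<^bsub>RC\<^esub> = (U, U)"
  "ba_compl RC (A, B) = (U - B, U - B)"
  by (simp_all add: center_def rough_set_alg_def)

lemma boolean_alg_RC: "boolean_alg RC"
  by unfold_locales
    (auto simp: carrier_RC RC_simps definable_empty definable_space definable_Diff
      definable_Un definable_Int, auto simp: definable_def)

section \<open>Order and completeness of the center\<close>

lemma order_RC_simps:
  "carrier (order_of RC) = (\<lambda>D. (D, D)) ` {D. definable U \<theta> D}"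
  "(C, C) \<sqsubseteq>\<^bsub>order_of RC\<^esub> (D, D) \<longleftrightarrow> C \<subseteq> D"
  "(p .=\<^bsub>order_of RC\<^esub> q) \<longleftrightarrow> p = q"
  by (auto simp: order_of_def carrier_RC RC_simps)

lemma partial_order_RC: "partial_order (order_of RC)"
  by unfold_locales (auto simp: order_RC_simps fun_eq_iff)

text \<open>The members of \<open>A\<close> are diagonal pairs, so \<open>fst\<close> recovers the
  underlying definable sets. Their union is again definable, and the order is inclusion.\<close>

lemma is_lub_RC:
  assumes "A \<subseteq> carrier (order_of RC)"
  shows "is_lub (order_of RC) (\<Union>p\<in>A. fst p, \<Union>p\<in>A. fst p) A"
proof -
  have A: "\<exists>D. p = (D, D) \<and> definable U \<theta> D" if "p \<in> A" for p
    using assms that by (auto simp: order_RC_simps)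
  then have "definable U \<theta> (\<Union>p\<in>A. fst p)"
    by (intro definable_UN) fastforce
  then show ?thesis
    using A by (fastforce simp: least_def Upper_def order_RC_simps)
qed

text \<open>Dual to the union case; for empty \<open>A\<close> the factor \<open>U\<close> gives the
  top element.\<close>

lemma is_glb_RC:
  assumes "A \<subseteq> carrier (order_of RC)"
  shows "is_glb (order_of RC) (U \<inter> (\<Inter>p\<in>A. fst p), U \<inter> (\<Inter>p\<in>A. fst p)) A"
proof -
  have A: "\<exists>D. p = (D, D) \<and> definable U \<theta> D" if "p \<in> A" for p
    using assms that by (auto simp: order_RC_simps)
  then have "definable U \<theta> (U \<inter> (\<Inter>p\<in>A. fst p))"
    by (intro definable_INT) fastforce
  moreover have "D \<subseteq> U" if "definable U \<theta> D" for D
    using that by (simp add: definable_def)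
  ultimately show ?thesis
    using A by (fastforce simp: greatest_def Lower_def order_RC_simps)
qed

lemma complete_lattice_RC: "complete_lattice (order_of RC)"
proof -
  interpret partial_order "order_of RC"
    by (rule partial_order_RC)
  show ?thesis
    by unfold_locales (blast intro: is_lub_RC is_glb_RC)+
qed

section \<open>Atoms of the center\<close>

lemma bottom_RC: "\<bottom>\<^bsub>order_of RC\<^esub> = ({}, {})"
  unfolding bottom_def
\<comment> \<open>The bottom is defined by choice of a least element, so uniqueness of least
  elements has to identify it.\<close>
proof (rule some_equality)
  show least: "least (order_of RC) ({}, {}) (carrier (order_of RC))"
    by (auto simp: least_def order_RC_simps definable_empty)
  show "p = ({}, {})" if "least (order_of RC) p (carrier (order_of RC))" for p
    using partial_order.least_unique[OF partial_order_RC that least] .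
qed

lemma class_mem_atoms:
  assumes "x \<in> U"
  shows "(\<theta> `` {x}, \<theta> `` {x}) \<in> atoms (order_of RC)"
proof -
  have "definable U \<theta> (\<theta> `` {x})"
    using assms by (simp add: definable_saturation)
  moreover have "x \<in> \<theta> `` {x}"
    using theta_refl[OF assms] by blast
  \<comment> \<open>A nonempty definable subset of a class contains some point of it, hence
    \<open>x\<close>, hence the whole class: nothing lies strictly between the empty set and a
    class.\<close>
  moreover have "D = \<theta> `` {x}" if D: "definable U \<theta> D" "D \<subseteq> \<theta> `` {x}" "D \<noteq> {}" for D
  proof -
    obtain y where "y \<in> D" "(x, y) \<in> \<theta>"
      using D by blast
    then have "x \<in> D"
      using definable_mem_cong[OF D(1)] by blast
    then show ?thesis
      using D by (auto simp: definable_def)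
  qed
  ultimately show ?thesis
    by (auto simp: atoms_def bottom_RC lless_def order_RC_simps)
qed

lemma atomistic_RC: "atomistic (order_of RC)"
  unfolding atomistic_def
proof
  fix p assume "p \<in> carrier (order_of RC)"
  then obtain D where p: "p = (D, D)" and D: "definable U \<theta> D"
    by (auto simp: order_RC_simps)
  \<comment> \<open>A definable set is the union of the classes of its points, and each of these is
    an atom.\<close>
  define A where "A = (\<lambda>x. (\<theta> `` {x}, \<theta> `` {x})) ` D"
  have A: "A \<subseteq> atoms (order_of RC)"
    using D class_mem_atoms by (auto simp: A_def definable_def)
  have "(\<Union>q\<in>A. fst q) = D"
    using D theta_refl by (auto simp: A_def definable_def)
  moreover have "A \<subseteq> carrier (order_of RC)"
    using A by (auto simp: atoms_def)
  ultimately have "is_lub (order_of RC) p A"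
    using is_lub_RC[of A] p by simp
  with A show "\<exists>A \<subseteq> atoms (order_of RC). is_lub (order_of RC) p A"
    by blast
qed

section \<open>The isomorphism onto the power set of the index set\<close>

lemma boolean_isomorphic_RC:
  assumes cls: "bij_betw cls E (U // \<theta>)"
  shows "boolean_isomorphic RC (powerset_alg E)"
proof -
  have "\<exists>x \<in> U. cls i = \<theta> `` {x}" if "i \<in> E" for i
    using bij_betwE[OF cls] that by (auto simp: quotient_def)
  then obtain r where r: "\<And>i. i \<in> E \<Longrightarrow> r i \<in> U \<and> cls i = \<theta> `` {r i}"
    by metis
  \<comment> \<open>Injectivity and surjectivity of \<open>cls\<close> say that the representatives
    \<open>r i\<close> meet every class exactly once.\<close>
  have r_inj: "i = j" if "i \<in> E" "j \<in> E" "(r i, r j) \<in> \<theta>" for i j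
    using cls that r equiv_class_eq[OF equiv that(3)] by (auto simp: bij_betw_def inj_on_def)
  have r_surj: "\<exists>i \<in> E. (r i, x) \<in> \<theta>" if "x \<in> U" for x
  proof -
    have "\<theta> `` {x} \<in> cls ` E"
      using cls that by (simp add: bij_betw_def quotientI)
    then obtain i where "i \<in> E" "\<theta> `` {r i} = \<theta> `` {x}"
      using r by auto
    then show ?thesis
      using theta_refl[OF that] by blast
  qed
  define f where "f p = {i \<in> E. r i \<in> fst p}" for p :: "'a set \<times> 'a set"
  have "bij_betw f (carrier RC) (carrier (powerset_alg E))"
  \<comment> \<open>The inverse sends \<open>S\<close> to the saturation of its representatives,
    that is, to the union of the classes \<open>cls i\<close> with \<open>i\<close> in
    \<open>S\<close>.\<close>
  proof (rule bij_betw_byWitness[where f' = "\<lambda>S. (\<theta> `` r ` S, \<theta> `` r ` S)"])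
    have "\<theta> `` r ` {i \<in> E. r i \<in> D} = D" if D: "definable U \<theta> D" for D
    proof
      show "\<theta> `` r ` {i \<in> E. r i \<in> D} \<subseteq> D"
        using D by (auto simp: definable_def)
      show "D \<subseteq> \<theta> `` r ` {i \<in> E. r i \<in> D}"
      proof
        fix x assume x: "x \<in> D"
        then have "x \<in> U"
          using D by (auto simp: definable_def)
        then obtain i where "i \<in> E" "(r i, x) \<in> \<theta>"
          using r_surj by blast
        then show "x \<in> \<theta> `` r ` {i \<in> E. r i \<in> D}"
          using definable_mem_cong[OF D] x by blast
      qed
    qed
    then show "\<forall>p \<in> carrier RC. (\<theta> `` r ` f p, \<theta> `` r ` f p) = p"
      by (auto simp: carrier_RC f_def)
    show "\<forall>S \<in> carrier (powerset_alg E). f (\<theta> `` r ` S, \<theta> `` r ` S) = S"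
    proof
      fix S assume "S \<in> carrier (powerset_alg E)"
      then have S: "S \<subseteq> E"
        by (simp add: powerset_alg_def)
      \<comment> \<open>Reflexivity puts each index of \<open>S\<close> back into the result;
        \<open>r_inj\<close> excludes all others.\<close>
      then have "(r i, r i) \<in> \<theta>" if "i \<in> S" for i
        using that r theta_refl by blast
      then show "f (\<theta> `` r ` S, \<theta> `` r ` S) = S"
        using S r_inj by (auto simp: f_def)
    qed
    show "f ` carrier RC \<subseteq> carrier (powerset_alg E)"
      by (auto simp: f_def powerset_alg_def)
    have "r ` S \<subseteq> U" if "S \<subseteq> E" for S
      using that r by blast
    then show "(\<lambda>S. (\<theta> `` r ` S, \<theta> `` r ` S)) ` carrier (powerset_alg E) \<subseteq> carrier RC"
      by (auto simp: carrier_RC powerset_alg_def intro!: definable_saturation)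
  qed
  \<comment> \<open>Up to the diagonal, \<open>f\<close> is the preimage along \<open>r\<close> on
    \<open>E\<close>, so it respects unions and intersections. Since \<open>r\<close> maps
    \<open>E\<close> into \<open>U\<close>, it also respects top and complements.\<close>
  then have "f \<in> boolean_iso RC (powerset_alg E)"
    using r by (auto simp: boolean_iso_def carrier_RC RC_simps f_def powerset_alg_def)
  then show ?thesis
    using boolean_alg_RC boolean_alg_powerset by (auto simp: boolean_isomorphic_def)
qed

end

theorem corollary2:
  fixes U :: "'a set" and \<theta> :: "('a \<times> 'a) set"
    and E :: "'i set" and cls :: "'i \<Rightarrow> 'a set"
  assumes "approximation_space U \<theta>"
    and "bij_betw cls E (U // \<theta>)"
  shows "carrier (center (rough_set_alg U \<theta>)) = crisp_sets U \<theta>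
    \<and> complete_lattice (order_of (center (rough_set_alg U \<theta>)))
    \<and> atomistic (order_of (center (rough_set_alg U \<theta>)))
    \<and> boolean_isomorphic (center (rough_set_alg U \<theta>)) (powerset_alg E)"
proof -
  interpret approximation_space U \<theta>
    by fact
  show ?thesis
    using complete_lattice_RC atomistic_RC boolean_isomorphic_RC[OF assms(2)]
    by (simp add: carrier_RC crisp_sets_eq)
qed

end
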